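(* Let $\mathcal I$ be an ideal on $\mathbb N$ which has the hereditary Baire property or is hereditary Lebesgue measurable (in particular, this holds if $\mathcal I$ is a Borel ideal). Then the following conditions are equivalent. (1) $AOS(\mathcal I)\neq\emptyset$. (2) $AOS(\mathcal I^* )\neq\emptyset$. (3) $AOS(\mathcal I)$ is $\mathfrak c$-lineable. (4) $AOS(\mathcal I^* )$ is $\mathfrak c$-lineable. (5) $AOS(\mathcal I)$ is spaceable. (6) $AOS(\mathcal I^* )$ is spaceable. (7) $\mathcal I_{1/n}\cap \mathcal I^+\neq \emptyset$.
   Context: $\mathbb N=\{1,2,\dots\}$; $\mathfrak c$ is the cardinality of the continuum. An ideal on $\mathbb N$ (and similarly on any infinite countable set in place of $\mathbb N$) is a nonempty family $\mathcal I\subseteq\mathcal P(\mathbb N)$ closed under subsets and finite unions, containing all finite subsets of $\mathbb N$, with $\mathbb N\notin\mathcal I$. $\mathcal I^*=\{\mathbb N\setminus A: A\in\mathcal I\}$ is the dual filter and $\mathcal I^+=\{A\subseteq\mathbb N:A\notin\mathcal I\}$ is the coideal. For $C\in\mathcal I^+$, $\mathcal I\upharpoonright C=\{A\cap C:A\in\mathcal I\}$, an ideal on $C$. For a countable infinite set $C$, identify $\mathcal P(C)$ with $\{0,1\}^C$ via characteristic functions, equipped with the product (Cantor space) topology and the product of the uniform probability measures on $\{0,1\}$; an ideal on $C$ has the Baire property, is Lebesgue measurable, or is Borel if it is such as a subset of $\{0,1\}^C$. An ideal $\mathcal I$ on $\mathbb N$ has the hereditary Baire property (is hereditary Lebesgue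 measurable) if $\mathcal I\upharpoonright C$ has the Baire property (is Lebesgue measurable, i.e. measurable with respect to the completed product measure) for every $C\in\mathcal I^+$. $\mathcal I_{1/n}=\{A\subseteq\mathbb N:\sum_{n\in A}\frac1n<\infty\}$ is the summable ideal. For a real sequence $(x_n)$: $(x_n)$ is $\mathcal I$-convergent to $0$ if $\{n:|x_n|\ge\varepsilon\}\in\mathcal I$ for every $\varepsilon>0$; it is $\mathcal I^*$-convergent to $0$ if there is $F\in\mathcal I^*$ such that the subsequence $(x_n)_{n\in F}$ converges to $0$ in the ordinary sense. $\ell_1$ is the Banach space of real sequences with absolutely convergent series, with norm $\lVert(a_n)\rVert=\sum_{n=1}^\infty|a_n|$. $AOS(\mathcal I)$ (resp. $AOS(\mathcal I^* )$) is the set of all $(a_n)\in\ell_1$ such that $(na_n)$ is not $\mathcal I$-convergent (resp. not $\mathcal I^*$-convergent) to zero. A subset $Y\subseteq\ell_1$ is $\kappa$-lineable if $Y\cup\{0\}$ contains a vector subspace of dimension $\kappa$, and spaceable if $Y\cup\{0\}$ contains a closed infinite-dimensional vector subspace. *)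

theory Defs
  imports "HOL-Probability.Probability" "HOL-Library.Equipollence"
begin

section \<open>Ideals on countable sets\<close>

definition set_ideal :: "'a set \<Rightarrow> 'a set set \<Rightarrow> bool" where
  "set_ideal X \<I> \<longleftrightarrow>
     \<I> \<subseteq> Pow X \<and> \<I> \<noteq> {} \<and>
     (\<forall>A B. A \<in> \<I> \<longrightarrow> B \<subseteq> A \<longrightarrow> B \<in> \<I>) \<and>
     (\<forall>A B. A \<in> \<I> \<longrightarrow> B \<in> \<I> \<longrightarrow> A \<union> B \<in> \<I>) \<and>
     (\<forall>A. finite A \<longrightarrow> A \<subseteq> X \<longrightarrow> A \<in> \<I>) \<and>
     X \<notin> \<I>"

definition dual_filter :: "'a set \<Rightarrow> 'a set set \<Rightarrow> 'a set set" where
  "dual_filter X \<I> = {X - A | A. A \<in> \<I>}"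

definition coideal :: "'a set \<Rightarrow> 'a set set \<Rightarrow> 'a set set" where
  "coideal X \<I> = {A. A \<subseteq> X \<and> A \<notin> \<I>}"

definition ideal_restrict :: "'a set set \<Rightarrow> 'a set \<Rightarrow> 'a set set" where
  "ideal_restrict \<I> C = {A \<inter> C | A. A \<in> \<I>}"


section \<open>Topology and measure on the power set\<close>

text \<open>Points of the Cantor space over \<open>C\<close> are the extensional functions from \<open>C\<close> to
  \<^typ>\<open>bool\<close>, so that the same carrier serves the product topology and the product measure.\<close>

definition char_fun :: "'a set \<Rightarrow> 'a set \<Rightarrow> 'a \<Rightarrow> bool" where
  "char_fun C A = (\<lambda>n\<in>C. n \<in> A)"

definition cantor_top :: "'a set \<Rightarrow> ('a \<Rightarrow> bool) topology" where
  "cantor_top C = product_topology (\<lambda>_. discrete_topology (UNIV :: bool set)) C"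

definition cantor_measure :: "'a set \<Rightarrow> ('a \<Rightarrow> bool) measure" where
  "cantor_measure C = PiM C (\<lambda>_. uniform_count_measure (UNIV :: bool set))"

definition nowhere_dense_in :: "'a topology \<Rightarrow> 'a set \<Rightarrow> bool" where
  "nowhere_dense_in X S \<longleftrightarrow> S \<subseteq> topspace X \<and> X interior_of (X closure_of S) = {}"

definition meager_in :: "'a topology \<Rightarrow> 'a set \<Rightarrow> bool" where
  "meager_in X S \<longleftrightarrow> (\<exists>\<N>. countable \<N> \<and> (\<forall>T\<in>\<N>. nowhere_dense_in X T) \<and> S = \<Union>\<N>)"

definition baire_property_in :: "'a topology \<Rightarrow> 'a set \<Rightarrow> bool" where
  "baire_property_in X S \<longleftrightarrow>
     (\<exists>U M. openin X U \<and> meager_in X M \<and> S = (U - M) \<union> (M - U))"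

definition borel_sets_of :: "'a topology \<Rightarrow> 'a set set" where
  "borel_sets_of X = sigma_sets (topspace X) {U. openin X U}"

definition baire_family :: "'a set \<Rightarrow> 'a set set \<Rightarrow> bool" where
  "baire_family C \<F> \<longleftrightarrow> baire_property_in (cantor_top C) (char_fun C ` \<F>)"

definition lebesgue_family :: "'a set \<Rightarrow> 'a set set \<Rightarrow> bool" where
  "lebesgue_family C \<F> \<longleftrightarrow> char_fun C ` \<F> \<in> sets (completion (cantor_measure C))"

definition borel_family :: "'a set \<Rightarrow> 'a set set \<Rightarrow> bool" where
  "borel_family C \<F> \<longleftrightarrow> char_fun C ` \<F> \<in> borel_sets_of (cantor_top C)"

definition hereditary_baire :: "'a set \<Rightarrow> 'a set set \<Rightarrow> bool" where
  "hereditary_baire X \<I> \<longleftrightarrow> (\<forall>C\<in>coideal X \<I>. baire_family C (ideal_restrict \<I> C))"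

definition hereditary_lebesgue :: "'a set \<Rightarrow> 'a set set \<Rightarrow> bool" where
  "hereditary_lebesgue X \<I> \<longleftrightarrow> (\<forall>C\<in>coideal X \<I>. lebesgue_family C (ideal_restrict \<I> C))"


section \<open>Ideals on the positive integers and ideal convergence\<close>

text \<open>The positive integers are the set \<open>{1..}\<close> of type \<^typ>\<open>nat set\<close>. A real sequence indexed
  by them is a function on \<^typ>\<open>nat\<close> whose value at \<open>0\<close> is irrelevant.\<close>

definition summable_ideal :: "nat set set" where
  "summable_ideal = {A. A \<subseteq> {1..} \<and> (\<lambda>n. 1 / real n) summable_on A}"

definition ideal_conv_zero :: "nat set set \<Rightarrow> (nat \<Rightarrow> real) \<Rightarrow> bool" where
  "ideal_conv_zero \<I> x \<longleftrightarrow> (\<forall>\<epsilon>>0. {n\<in>{1..}. \<bar>x n\<bar> \<ge> \<epsilon>} \<in> \<I>)"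

text \<open>Members of the dual filter are infinite, so \<^const>\<open>enumerate\<close> lists them increasingly.\<close>

definition dual_conv_zero :: "nat set set \<Rightarrow> (nat \<Rightarrow> real) \<Rightarrow> bool" where
  "dual_conv_zero \<I> x \<longleftrightarrow>
     (\<exists>F\<in>dual_filter {1..} \<I>. (\<lambda>k. x (enumerate F k)) \<longlonglongrightarrow> 0)"


section \<open>The normed space of absolutely summable sequences\<close>

text \<open>The terms are indexed by \<open>{1..}\<close>; the unused entry at index \<open>0\<close> is fixed to be \<open>0\<close>, so that
  it neither adds a dimension nor contributes to the norm.\<close>

typedef ell1 = "{a :: nat \<Rightarrow> real. a 0 = 0 \<and> summable (\<lambda>n. \<bar>a n\<bar>)}"
  morphisms ell1_nth Abs_ell1
  by (rule exI[of _ "\<lambda>_. 0"]) simp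

setup_lifting type_definition_ell1

lemma ell1_nth_0: "ell1_nth a 0 = 0"
  using ell1_nth[of a] by simp

lemma ell1_summable: "summable (\<lambda>n. \<bar>ell1_nth a n\<bar>)"
  using ell1_nth[of a] by simp

lemma abs_summable_add_real:
  fixes a b :: "nat \<Rightarrow> real"
  assumes "summable (\<lambda>n. \<bar>a n\<bar>)" and "summable (\<lambda>n. \<bar>b n\<bar>)"
  shows "summable (\<lambda>n. \<bar>a n + b n\<bar>)" and "summable (\<lambda>n. \<bar>a n - b n\<bar>)"
  by (rule summable_comparison_test'[OF summable_add[OF assms], of 0]; simp)+

instantiation ell1 :: real_vector
begin

lift_definition zero_ell1 :: ell1 is "\<lambda>_. 0" by simp

lift_definition plus_ell1 :: "ell1 \<Rightarrow> ell1 \<Rightarrow> ell1" is "\<lambda>a b n. a n + b n"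
  by (simp add: abs_summable_add_real)

lift_definition uminus_ell1 :: "ell1 \<Rightarrow> ell1" is "\<lambda>a n. - a n" by simp

lift_definition minus_ell1 :: "ell1 \<Rightarrow> ell1 \<Rightarrow> ell1" is "\<lambda>a b n. a n - b n"
  by (simp add: abs_summable_add_real)

lift_definition scaleR_ell1 :: "real \<Rightarrow> ell1 \<Rightarrow> ell1" is "\<lambda>c a n. c * a n"
  by (auto simp: abs_mult)

instance
  by standard (transfer; simp add: fun_eq_iff algebra_simps)+

end

instantiation ell1 :: real_normed_vector
begin

lift_definition norm_ell1 :: "ell1 \<Rightarrow> real" is "\<lambda>a. \<Sum>n. \<bar>a n\<bar>" .

definition dist_ell1 :: "ell1 \<Rightarrow> ell1 \<Rightarrow> real" where
  "dist_ell1 a b = norm (a - b)"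

definition sgn_ell1 :: "ell1 \<Rightarrow> ell1" where
  "sgn_ell1 a = a /\<^sub>R norm a"

definition uniformity_ell1 :: "(ell1 \<times> ell1) filter" where
  "uniformity_ell1 = (INF e\<in>{0<..}. principal {(x, y). dist x y < e})"

definition open_ell1 :: "ell1 set \<Rightarrow> bool" where
  "open_ell1 U \<longleftrightarrow> (\<forall>x\<in>U. eventually (\<lambda>(x', y). x' = x \<longrightarrow> y \<in> U) uniformity)"

instance
proof
  fix a b :: ell1 and c :: real
  show "(norm a = 0) = (a = 0)"
    by transfer (simp add: suminf_eq_zero_iff fun_eq_iff)
  show "norm (a + b) \<le> norm a + norm b"
  proof transfer
    fix a b :: "nat \<Rightarrow> real"
    assume "a 0 = 0 \<and> summable (\<lambda>n. \<bar>a n\<bar>)" and "b 0 = 0 \<and> summable (\<lambda>n. \<bar>b n\<bar>)"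
    then have a: "summable (\<lambda>n. \<bar>a n\<bar>)" and b: "summable (\<lambda>n. \<bar>b n\<bar>)" by auto
    have ab: "summable (\<lambda>n. \<bar>a n + b n\<bar>)"
      by (rule abs_summable_add_real(1)[OF a b])
    have "(\<Sum>n. \<bar>a n + b n\<bar>) \<le> (\<Sum>n. \<bar>a n\<bar> + \<bar>b n\<bar>)"
      by (rule suminf_le[OF _ ab summable_add[OF a b]]) auto
    then show "(\<Sum>n. \<bar>a n + b n\<bar>) \<le> (\<Sum>n. \<bar>a n\<bar>) + (\<Sum>n. \<bar>b n\<bar>)"
      by (simp add: suminf_add[OF a b])
  qed
  show "norm (c *\<^sub>R a) = \<bar>c\<bar> * norm a"
    by transfer (simp add: abs_mult suminf_mult)
qed (simp_all only: dist_ell1_def sgn_ell1_def uniformity_ell1_def open_ell1_def)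

end

lemma norm_ell1_sums: "(\<lambda>n. \<bar>ell1_nth a (Suc n)\<bar>) sums norm a"
  using summable_sums[OF ell1_summable[of a]] sums_Suc_iff[of "\<lambda>n. \<bar>ell1_nth a n\<bar>"]
  by (simp add: norm_ell1.rep_eq ell1_nth_0)

definition AOS_ideal :: "nat set set \<Rightarrow> ell1 set" where
  "AOS_ideal \<I> = {a. \<not> ideal_conv_zero \<I> (\<lambda>n. real n * ell1_nth a n)}"

definition AOS_dual :: "nat set set \<Rightarrow> ell1 set" where
  "AOS_dual \<I> = {a. \<not> dual_conv_zero \<I> (\<lambda>n. real n * ell1_nth a n)}"


section \<open>Lineability and spaceability\<close>

text \<open>The cardinal is given by a representing set \<open>K\<close>.\<close>

definition lineable :: "'k set \<Rightarrow> 'a::real_vector set \<Rightarrow> bool" where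
  "lineable K Y \<longleftrightarrow>
     (\<exists>V B. subspace V \<and> V \<subseteq> Y \<union> {0} \<and> independent B \<and> span B = V \<and> B \<approx> K)"

definition spaceable :: "'a::real_normed_vector set \<Rightarrow> bool" where
  "spaceable Y \<longleftrightarrow>
     (\<exists>V. subspace V \<and> closed V \<and> V \<subseteq> Y \<union> {0} \<and> \<not> (\<exists>B. finite B \<and> span B = V))"

end

theory Submission
  imports Defs
begin

text \<open>A hereditarily Baire or hereditarily measurable ideal is not maximal on any set \<open>C\<close> outside it:
  exchanging sets with their complements would swap a maximal ideal with the rest of the Cantor space,
  which contradicts the Baire category theorem in the first case and the zero-one law for tail sets
  in the second. Hence such \<open>C\<close> splits repeatedly into infinitely many disjoint sets outside the
  ideal. If \<open>\<Sum>n\<in>C. 1/n\<close> converges, the sequences \<open>a\<close> for which \<open>n * a n\<close> is constant on each of these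
  sets and zero elsewhere form a closed subspace of dimension at least continuum. Conversely, for
  \<open>a\<close> in \<open>\<ell>\<^sub>1\<close> the terms \<open>n * a n\<close> tend to zero outside a set on which \<open>1/n\<close> is summable.\<close>

section \<open>Coordinate flips\<close>

text \<open>Symmetric difference with \<open>F\<close>, seen on characteristic functions. Cutting
  off outside \<open>X\<close> keeps the result a point of the Cantor space.\<close>

definition flip :: "'a set \<Rightarrow> 'a set \<Rightarrow> ('a \<Rightarrow> bool) \<Rightarrow> 'a \<Rightarrow> bool" where
  "flip X F x = (\<lambda>i\<in>X. x i \<noteq> (i \<in> F))"

lemma flip_in_extensional [simp]: "flip X F x \<in> extensional X"
  by (simp add: flip_def)

lemma flip_flip: "x \<in> extensional X \<Longrightarrow> flip X F (flip X F x) = x"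
  by (auto simp: flip_def extensional_def fun_eq_iff)

lemma topspace_cantor_top [simp]: "topspace (cantor_top X) = extensional X"
  by (auto simp: cantor_top_def PiE_def)

lemma space_cantor_measure [simp]: "space (cantor_measure X) = extensional X"
  by (auto simp: cantor_measure_def space_PiM PiE_def space_uniform_count_measure)

text \<open>Every extensional function is the characteristic function of exactly one subset of
  \<open>X\<close>, so points can be traded for sets. Containment in \<open>Pow X\<close> lets a
  member be recovered from its characteristic function.\<close>

lemma mem_char_fun_image_iff:
  assumes "\<F> \<subseteq> Pow X"
  shows "x \<in> char_fun X ` \<F> \<longleftrightarrow> x \<in> extensional X \<and> {i \<in> X. x i} \<in> \<F>"
proof
  assume "x \<in> char_fun X ` \<F>"
  then obtain A where A: "A \<in> \<F>" "x = char_fun X A" by auto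
  with assms have "{i \<in> X. x i} = A" by (auto simp: char_fun_def)
  with A show "x \<in> extensional X \<and> {i \<in> X. x i} \<in> \<F>" by (simp add: char_fun_def)
next
  assume x: "x \<in> extensional X \<and> {i \<in> X. x i} \<in> \<F>"
  then have "x = char_fun X {i \<in> X. x i}"
    by (auto simp: char_fun_def extensional_def fun_eq_iff)
  then show "x \<in> char_fun X ` \<F>" using x by (intro image_eqI) auto
qed

lemma set_idealD:
  assumes "set_ideal X \<J>"
  shows "\<J> \<subseteq> Pow X" "\<And>A B. A \<in> \<J> \<Longrightarrow> B \<subseteq> A \<Longrightarrow> B \<in> \<J>"
    "\<And>A B. A \<in> \<J> \<Longrightarrow> B \<in> \<J> \<Longrightarrow> A \<union> B \<in> \<J>"
    "\<And>A. finite A \<Longrightarrow> A \<subseteq> X \<Longrightarrow> A \<in> \<J>" "X \<notin> \<J>" "{} \<in> \<J>"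
  using assms unfolding set_ideal_def by (meson finite.emptyI empty_subsetI)+

text \<open>Maximality in its ultrafilter form: the dual filter decides every subset of
  \<open>X\<close>.\<close>

definition maximal_set_ideal :: "'a set \<Rightarrow> 'a set set \<Rightarrow> bool" where
  "maximal_set_ideal X \<J> \<longleftrightarrow> set_ideal X \<J> \<and> (\<forall>A\<subseteq>X. A \<in> \<J> \<or> X - A \<in> \<J>)"

text \<open>An ideal is a tail set: it contains the finite set \<open>F\<close>, so changing
  coordinates in \<open>F\<close> does not affect membership.\<close>

lemma flip_finite_mem_iff:
  assumes "set_ideal X \<J>" "finite F" "F \<subseteq> X"
  shows "flip X F x \<in> char_fun X ` \<J> \<longleftrightarrow> {i \<in> X. x i} \<in> \<J>"
proof -
  note I = set_idealD[OF assms(1)]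
  have F: "F \<in> \<J>" using I(4) assms by auto
  let ?A = "{i \<in> X. x i}" and ?B = "{i \<in> X. flip X F x i}"
  have 1: "?A \<subseteq> ?B \<union> F" and 2: "?B \<subseteq> ?A \<union> F" by (auto simp: flip_def)
  have "?A \<in> \<J> \<longleftrightarrow> ?B \<in> \<J>" using I(2)[OF I(3)[OF _ F] 1] I(2)[OF I(3)[OF _ F] 2] by blast
  then show ?thesis by (simp add: mem_char_fun_image_iff[OF I(1)])
qed

text \<open>Flipping off \<open>F\<close> amounts to complementing everything and then changing the
  finite set \<open>F\<close>; a maximal ideal contains exactly one of a set and its
  complement.\<close>

lemma flip_cofinite_mem_iff:
  assumes "maximal_set_ideal X \<J>" "finite F" "F \<subseteq> X"
  shows "flip X (X - F) x \<in> char_fun X ` \<J> \<longleftrightarrow> {i \<in> X. x i} \<notin> \<J>"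
proof -
  have id: "set_ideal X \<J>" and max: "\<And>A. A \<subseteq> X \<Longrightarrow> A \<in> \<J> \<or> X - A \<in> \<J>"
    using assms unfolding maximal_set_ideal_def by blast+
  note I = set_idealD[OF id]
  let ?y = "\<lambda>i. \<not> x i"
  let ?A = "{i \<in> X. x i}" and ?B = "{i \<in> X. \<not> x i}"
  have "flip X (X - F) x = flip X F ?y" by (auto simp: flip_def)
  moreover have "?B \<in> \<J> \<longleftrightarrow> ?A \<notin> \<J>"
  proof -
    have "?A \<union> ?B = X" "X - ?A = ?B" by auto
    then show ?thesis using I(3)[of ?A ?B] I(5) max[of ?A] by (metis Un_upper1)
  qed
  ultimately show ?thesis using flip_finite_mem_iff[OF id assms(2,3), of ?y] by simp
qed

section \<open>Baire category\<close>

lemma continuous_map_flip: "continuous_map (cantor_top X) (cantor_top X) (flip X F)"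
proof -
  have "continuous_map (cantor_top X) (discrete_topology UNIV) (\<lambda>x. flip X F x k)" if "k \<in> X" for k
  proof -
    have 1: "continuous_map (cantor_top X) (discrete_topology UNIV) (\<lambda>x. x k)"
      unfolding cantor_top_def by (rule continuous_map_product_projection[OF that])
    have "continuous_map (cantor_top X) (discrete_topology UNIV) ((\<lambda>b. b \<noteq> (k \<in> F)) \<circ> (\<lambda>x. x k))"
      by (rule continuous_map_compose[OF 1]) simp
    with that show ?thesis by (simp add: flip_def o_def)
  qed
  then show ?thesis
    unfolding cantor_top_def continuous_map_componentwise
    by (auto simp: cantor_top_def[symmetric])
qed

lemma homeomorphic_map_flip: "homeomorphic_map (cantor_top X) (cantor_top X) (flip X F)"
  by (rule homeomorphic_maps_imp_map[of _ _ _ "flip X F"])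
     (auto simp: homeomorphic_maps_def continuous_map_flip flip_flip)

text \<open>Homeomorphisms commute with closure and interior, so nowhere density is preserved piece
  by piece.\<close>

lemma meager_in_homeomorphic_image:
  assumes h: "homeomorphic_map X Y h" and "meager_in X S"
  shows "meager_in Y (h ` S)"
proof -
  obtain N where N: "countable N" "\<And>T. T \<in> N \<Longrightarrow> nowhere_dense_in X T" "S = \<Union>N"
    using assms by (auto simp: meager_in_def)
  have "nowhere_dense_in Y (h ` T)" if "T \<in> N" for T
    using N(2)[OF that] homeomorphic_imp_surjective_map[OF h]
    by (auto simp: nowhere_dense_in_def homeomorphic_map_closure_of[OF h]
        homeomorphic_map_interior_of[OF h closure_of_subset_topspace])
  moreover have "h ` S = \<Union>((`) h ` N)" using N(3) by auto
  ultimately show ?thesis using N(1) unfolding meager_in_def by (intro exI[of _ "(`) h ` N"]) auto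
qed

lemma meager_in_Un:
  assumes "meager_in X S" "meager_in X T"
  shows "meager_in X (S \<union> T)"
proof -
  obtain M N where "countable M" "\<forall>T\<in>M. nowhere_dense_in X T" "S = \<Union>M"
      "countable N" "\<forall>T\<in>N. nowhere_dense_in X T" "T = \<Union>N"
    using assms unfolding meager_in_def by auto
  then show ?thesis unfolding meager_in_def by (intro exI[of _ "M \<union> N"]) auto
qed

text \<open>The Baire category theorem for a compact Hausdorff space, applied to the closures of the
  nowhere dense pieces.\<close>

lemma cantor_top_openin_meager:
  assumes U: "openin (cantor_top X) U" "U \<subseteq> S" and S: "meager_in (cantor_top X) S"
  shows "U = {}"
proof -
  obtain N where N: "countable N" "\<And>T. T \<in> N \<Longrightarrow> nowhere_dense_in (cantor_top X) T" "S = \<Union>N"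
    using S by (auto simp: meager_in_def)
  let ?G = "(closure_of) (cantor_top X) ` N"
  have comp: "compact_space (cantor_top X)"
    unfolding cantor_top_def compact_space_product_topology
    by (simp add: compact_space_discrete_topology)
  have haus: "Hausdorff_space (cantor_top X)"
    unfolding cantor_top_def Hausdorff_space_product_topology
    by (simp add: Hausdorff_space_discrete_topology)
  have "(cantor_top X) interior_of \<Union>?G = {}"
  proof (rule Baire_category_alt)
    show "completely_metrizable_space (cantor_top X) \<or>
        locally_compact_space (cantor_top X) \<and> regular_space (cantor_top X)"
      using comp haus
      by (simp add: compact_imp_locally_compact_space compact_Hausdorff_imp_regular_space)
    show "countable ?G" using N by simp
    show "closedin (cantor_top X) T \<and> (cantor_top X) interior_of T = {}" if "T \<in> ?G" for T
      using that N(2) by (auto simp: nowhere_dense_in_def)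
  qed
  moreover have "U \<subseteq> \<Union>?G"
  proof -
    have "T \<subseteq> (cantor_top X) closure_of T" if "T \<in> N" for T
      using N(2)[OF that] by (intro closure_of_subset) (simp add: nowhere_dense_in_def)
    with U N(3) show ?thesis by blast
  qed
  ultimately show ?thesis using interior_of_maximal[OF _ U(1), of "\<Union>?G"] by auto
qed

text \<open>A basic box around \<open>p\<close> restricts only finitely many coordinates; shrinking
  each restricted factor to the value of \<open>p\<close> turns it into a cylinder, which flips off
  \<open>F\<close> leave invariant.\<close>

lemma cantor_top_basis:
  assumes "openin (cantor_top X) U" "p \<in> U"
  obtains F where "finite F" "F \<subseteq> X" "{x \<in> extensional X. \<forall>i\<in>F. x i = p i} \<subseteq> U"
    "openin (cantor_top X) {x \<in> extensional X. \<forall>i\<in>F. x i = p i}"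
proof -
  obtain V where V: "finite {i \<in> X. V i \<noteq> UNIV}" "p \<in> Pi\<^sub>E X V" "Pi\<^sub>E X V \<subseteq> U"
    using assms unfolding cantor_top_def openin_product_topology_alt by force
  let ?F = "{i \<in> X. V i \<noteq> UNIV}"
  let ?W = "{x \<in> extensional X. \<forall>i\<in>?F. x i = p i}"
  have eq: "?W = Pi\<^sub>E X (\<lambda>i. if i \<in> ?F then {p i} else UNIV)"
    by (auto simp: PiE_def Pi_def split: if_splits)
  have "?W \<subseteq> Pi\<^sub>E X V"
  proof
    fix x assume x: "x \<in> ?W"
    have "x i \<in> V i" if "i \<in> X" for i
    proof (cases "V i = UNIV")
      case False
      then show ?thesis using x that PiE_mem[OF V(2) that] by simp
    qed simp
    then show "x \<in> Pi\<^sub>E X V" using x by (simp add: PiE_def)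
  qed
  moreover have "openin (cantor_top X) ?W"
    unfolding eq cantor_top_def
    by (subst openin_PiE_gen) (auto intro: rev_finite_subset[OF V(1)])
  ultimately show ?thesis using V(1,3) by (intro that[of ?F]) auto
qed

text \<open>If the ideal is comeager in a cylinder (or meager), then flipping all coordinates outside the
  support of the cylinder preserves the cylinder and exchanges the ideal with its complement, so the
  cylinder (or the whole space) is meager.\<close>

lemma maximal_set_ideal_not_baire:
  assumes "maximal_set_ideal X \<J>"
  shows "\<not> baire_family X \<J>"
proof
  assume "baire_family X \<J>"
  let ?S = "char_fun X ` \<J>" and ?T = "cantor_top X"
  obtain U M where U: "openin ?T U" and M: "meager_in ?T M" and S: "?S = (U - M) \<union> (M - U)"
    using \<open>baire_family X \<J>\<close> by (auto simp: baire_family_def baire_property_in_def)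
  have id: "set_ideal X \<J>" using assms by (simp add: maximal_set_ideal_def)
  note mem = mem_char_fun_image_iff[OF set_idealD(1)[OF id]]
  \<comment> \<open>Both cases deliver a nonempty open \<open>W\<close> stable under the flip off
    \<open>F\<close>: a cylinder inside \<open>U\<close> if \<open>U\<close> is nonempty, and the
    whole space otherwise.\<close>
  obtain F W where F: "finite F" "F \<subseteq> X" and W: "openin ?T W" "W \<noteq> {}"
    and flW: "\<And>x. x \<in> W \<Longrightarrow> flip X (X - F) x \<in> W" and alt: "W \<subseteq> U \<or> U = {}"
  proof (cases "U = {}")
    case True
    have "char_fun X {} \<in> extensional X" by (simp add: char_fun_def)
    then show ?thesis using True openin_topspace[of ?T] by (intro that[of "{}" "topspace ?T"]) auto
  next
    case False
    then obtain p where p: "p \<in> U" by auto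
    obtain F where F: "finite F" "F \<subseteq> X" "{x \<in> extensional X. \<forall>i\<in>F. x i = p i} \<subseteq> U"
        "openin ?T {x \<in> extensional X. \<forall>i\<in>F. x i = p i}"
      using cantor_top_basis[OF U p] .
    have "p \<in> extensional X" using openin_subset[OF U] p by auto
    moreover have "flip X (X - F) x i = p i" if "i \<in> F" "x i = p i" for x i
      using that F(2) by (auto simp: flip_def)
    ultimately show ?thesis using F
      by (intro that[of F "{x \<in> extensional X. \<forall>i\<in>F. x i = p i}"]) auto
  qed
  let ?f = "flip X (X - F)"
  have Wext: "W \<subseteq> extensional X" using openin_subset[OF W(1)] by simp
  have "W \<subseteq> M \<union> ?f ` M"
  proof
    fix x assume x: "x \<in> W"
    have xe: "x \<in> extensional X" using x Wext by auto
    have "?f x \<in> ?S \<longleftrightarrow> x \<notin> ?S"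
      using flip_cofinite_mem_iff[OF assms F, of x] xe by (simp add: mem)
    \<comment> \<open>Exactly one of \<open>x\<close> and \<open>?f x\<close> lies in
      \<open>?S\<close>. If \<open>W\<close> is inside \<open>U\<close>, the one outside
      \<open>?S\<close> is in \<open>M\<close>; if \<open>U\<close> is empty, \<open>?S\<close>
      equals \<open>M\<close> and the other one is.\<close>
    then have "x \<in> M \<or> ?f x \<in> M" using alt x flW[OF x] unfolding S by blast
    then show "x \<in> M \<union> ?f ` M" using flip_flip[OF xe, of "X - F"] by (metis UnI1 UnI2 imageI)
  qed
  moreover have "meager_in ?T (M \<union> ?f ` M)"
    by (intro meager_in_Un M meager_in_homeomorphic_image[OF homeomorphic_map_flip])
  ultimately show False using cantor_top_openin_meager[OF W(1)] W(2) by blast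
qed

section \<open>Lebesgue measurability\<close>

text \<open>A set of the completion is a measurable set up to part of a null set, and preimages of
  null sets under a measure preserving map are null. This carries invariance from \<open>M\<close>
  over to its completion.\<close>

lemma measure_preserving_completion:
  assumes T: "T \<in> M \<rightarrow>\<^sub>M M" and d: "distr M M T = M" and S: "S \<in> sets (completion M)"
  shows "T -` S \<inter> space M \<in> sets (completion M)"
    and "measure (completion M) (T -` S \<inter> space M) = measure (completion M) S"
proof -
  obtain A N N' where S': "S = A \<union> N" "N \<subseteq> N'" "N' \<in> null_sets M" "A \<in> sets M"
    using sets_completionE[OF S] .
  have em: "emeasure M (T -` B \<inter> space M) = emeasure M B" if "B \<in> sets M" for B
    using emeasure_distr[OF T that] d by simp
  have nul: "T -` N' \<inter> space M \<in> null_sets M"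
    using S'(3) em[of N'] T by (auto simp: null_sets_def)
  have nul2: "T -` N \<inter> space M \<in> null_sets (completion M)"
    by (rule null_sets_completion_subset[OF _ null_sets_completionI[OF nul]]) (use S' in auto)
  have nul3: "N \<in> null_sets (completion M)"
    by (rule null_sets_completion_subset[OF S'(2) null_sets_completionI[OF S'(3)]])
  have A: "T -` A \<inter> space M \<in> sets M" using T S'(4) by auto
  have eq: "T -` S \<inter> space M = (T -` A \<inter> space M) \<union> (T -` N \<inter> space M)" using S' by auto
  show "T -` S \<inter> space M \<in> sets (completion M)"
    unfolding eq using A nul2 by auto
  have "measure (completion M) (T -` S \<inter> space M) = measure (completion M) (T -` A \<inter> space M)"
    unfolding eq using A nul2 by (intro measure_Un_null_set) auto
  also have "\<dots> = measure (completion M) A"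
    using A S'(4) em[of A] by (simp add: measure_def)
  also have "\<dots> = measure (completion M) S"
    unfolding S'(1) using nul3 S'(4) by (intro measure_Un_null_set[symmetric]) auto
  finally show "measure (completion M) (T -` S \<inter> space M) = measure (completion M) S" .
qed

lemma prob_space_coin: "prob_space (uniform_count_measure (UNIV :: bool set))"
  by (rule prob_space_uniform_count_measure) auto

lemma prob_space_cantor_measure: "prob_space (cantor_measure X)"
  unfolding cantor_measure_def by (intro prob_space_PiM prob_space_coin)

lemma measurable_flip [measurable]: "flip X F \<in> cantor_measure X \<rightarrow>\<^sub>M cantor_measure X"
  unfolding cantor_measure_def
proof (rule measurable_PiM_single')
  show "flip X F \<in> space (Pi\<^sub>M X (\<lambda>_. uniform_count_measure UNIV)) \<rightarrow>
      (\<Pi>\<^sub>E i\<in>X. space (uniform_count_measure UNIV))"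
    by (auto simp: space_uniform_count_measure PiE_def)
  fix i assume i: "i \<in> X"
  have "(\<lambda>x. x i \<noteq> (i \<in> F)) \<in> Pi\<^sub>M X (\<lambda>_. uniform_count_measure UNIV) \<rightarrow>\<^sub>M uniform_count_measure UNIV"
    using i by (intro measurable_compose[OF measurable_component_singleton[OF i]])
      (auto simp: measurable_def space_uniform_count_measure sets_uniform_count_measure)
  with i show "(\<lambda>x. flip X F x i) \<in> Pi\<^sub>M X (\<lambda>_. uniform_count_measure UNIV) \<rightarrow>\<^sub>M uniform_count_measure UNIV"
    by (simp add: flip_def)
qed

text \<open>The factors are the fair-coin probabilities of the sets \<open>A i\<close>.\<close>

lemma emeasure_cantor_box:
  assumes "finite J" "J \<subseteq> X"
  shows "emeasure (cantor_measure X) {x \<in> extensional X. \<forall>i\<in>J. x i \<in> A i} =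
    (\<Prod>i\<in>J. ennreal (card (A i) / 2))"
proof -
  interpret product_prob_space "\<lambda>_. uniform_count_measure (UNIV :: bool set)" X
    by (intro product_prob_spaceI prob_space_coin)
  have "{x \<in> extensional X. \<forall>i\<in>J. x i \<in> A i} = emb X J (Pi\<^sub>E J A)"
    using assms(2)
    by (auto simp: prod_emb_def PiE_def Pi_def space_uniform_count_measure)
  then show ?thesis unfolding cantor_measure_def
    using emeasure_PiM_emb[OF assms(2,1), of A]
    by (simp add: sets_uniform_count_measure emeasure_uniform_count_measure)
qed

text \<open>Finite-dimensional boxes determine a finite measure on the product, and a flip permutes
  the two values of each coordinate, so it preserves the probability of every box.\<close>

lemma distr_flip: "distr (cantor_measure X) (cantor_measure X) (flip X F) = cantor_measure X"
proof -
  interpret P: prob_space "cantor_measure X" by (rule prob_space_cantor_measure)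
  interpret D: prob_space "distr (cantor_measure X) (cantor_measure X) (flip X F)"
    by (rule P.prob_space_distr) measurable
  show ?thesis
  proof (rule measure_eqI_PiM_infinite[where I=X and M="\<lambda>_. uniform_count_measure UNIV"])
    fix J and A :: "'a \<Rightarrow> bool set" assume J: "finite J" "J \<subseteq> X"
    let ?M = "\<lambda>_. uniform_count_measure (UNIV :: bool set)"
    let ?b = "\<lambda>A. {x \<in> extensional X. \<forall>i\<in>J. x i \<in> A i}"
    have box: "prod_emb X ?M J (Pi\<^sub>E J A) = ?b A"
      using J(2) by (auto simp: prod_emb_def PiE_def Pi_def space_uniform_count_measure)
    have ms: "prod_emb X ?M J (Pi\<^sub>E J A) \<in> sets (cantor_measure X)"
      unfolding cantor_measure_def using J
      by (intro sets_PiM_I) (auto simp: sets_uniform_count_measure)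
    have *: "flip X F -` ?b A \<inter> space (cantor_measure X) =
        ?b (\<lambda>i. (\<lambda>b. b \<noteq> (i \<in> F)) -` A i)"
      using J(2) by (auto simp: flip_def)
    have "card ((\<lambda>b. b \<noteq> c) -` B) = card B" for c :: bool and B
      by (intro card_vimage_inj) (auto simp: inj_def intro!: rangeI intro: range_eqI[of _ _ "_ \<noteq> c"])
    then show "emeasure (distr (cantor_measure X) (cantor_measure X) (flip X F)) (prod_emb X ?M J (Pi\<^sub>E J A)) =
        emeasure (cantor_measure X) (prod_emb X ?M J (Pi\<^sub>E J A))"
      unfolding emeasure_distr[OF measurable_flip ms] unfolding box * emeasure_cantor_box[OF J] by simp
  qed (auto simp: cantor_measure_def[symmetric] D.finite_measure)
qed

text \<open>The zero-one law, proved directly: complementation forces probability 1/2, and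
  invariance under single flips makes the ideal independent of all boxes, hence of every measurable
  set, including its own measurable part.\<close>

lemma maximal_set_ideal_not_lebesgue:
  assumes "maximal_set_ideal X \<J>"
  shows "\<not> lebesgue_family X \<J>"
proof
  define M where "M = cantor_measure X"
  define C where "C = completion M"
  define S where "S = char_fun X ` \<J>"
  assume "lebesgue_family X \<J>"
  then have S: "S \<in> sets C" by (simp add: lebesgue_family_def S_def C_def M_def)
  have id: "set_ideal X \<J>" using assms by (simp add: maximal_set_ideal_def)
  note mem = mem_char_fun_image_iff[OF set_idealD(1)[OF id], folded S_def]
  interpret M: prob_space M unfolding M_def by (rule prob_space_cantor_measure)
  interpret C: prob_space C unfolding C_def by (rule M.prob_space_completion)
  have spM [simp]: "space M = extensional X" "space C = extensional X"
    by (simp_all add: M_def C_def)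
  have pres: "flip X F -` A \<inter> extensional X \<in> sets C"
      "measure C (flip X F -` A \<inter> extensional X) = measure C A" if "A \<in> sets C" for F A
    using measure_preserving_completion[OF measurable_flip distr_flip that[unfolded C_def M_def], where F1=F]
    by (simp_all add: C_def M_def)
  have half: "measure C S = 1 / 2"
  proof -
    \<comment> \<open>The flip of all coordinates exchanges \<open>S\<close> with its complement, so
      both have the same probability.\<close>
    have "flip X X -` S \<inter> extensional X = space C - S"
      using flip_cofinite_mem_iff[OF assms, of "{}"] by (auto simp: mem S_def[symmetric])
    with pres(2)[OF S, of X] C.prob_compl[OF S] show ?thesis by simp
  qed
  define b where "b = (\<lambda>J (A :: 'a \<Rightarrow> bool set). {x \<in> extensional X. \<forall>i\<in>J. x i \<in> A i})"
  have box: "prod_emb X (\<lambda>_. uniform_count_measure UNIV) J (Pi\<^sub>E J A) = b J A" if "J \<subseteq> X" for J A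
    using that by (auto simp: b_def prod_emb_def PiE_def Pi_def space_uniform_count_measure)
  have bM: "b J A \<in> sets M" if "finite J" "J \<subseteq> X" for J A
    unfolding box[OF that(2), symmetric] M_def cantor_measure_def using that
    by (intro sets_PiM_I) (auto simp: sets_uniform_count_measure)
  have bC: "b J A \<in> sets C" if "finite J" "J \<subseteq> X" for J A
    using bM[OF that] by (simp add: C_def)
  \<comment> \<open>Independence of \<open>S\<close> from boxes, obtained by adding one coordinate
    at a time.\<close>
  have ind: "measure C (S \<inter> b J A) = 1 / 2 * (\<Prod>i\<in>J. card (A i) / 2)" if "finite J" "J \<subseteq> X" for J A
    using that
  proof (induction J)
    case empty
    have "S \<inter> b {} A = S" by (auto simp: b_def mem)
    then show ?case by (simp add: half)
  next
    case (insert i J)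
    then have J: "finite J" "J \<subseteq> X" "i \<in> X" "i \<notin> J" by auto
    let ?c = "\<lambda>v. {x \<in> S \<inter> b J A. x i = v}"
    have cb: "?c v = S \<inter> b (insert i J) (A(i := {v}))" for v
      using J by (auto simp: b_def)
    have cC: "?c v \<in> sets C" for v
      unfolding cb using S bC[of "insert i J"] J by auto
    \<comment> \<open>Flipping coordinate \<open>i\<close> alone preserves \<open>S\<close>, because
      the change is finite, and \<open>b J A\<close>, because \<open>i\<close> is not in
      \<open>J\<close>. So it exchanges the two slices, which must have equal measure.\<close>
    have sw: "flip X {i} -` ?c v \<inter> extensional X = ?c (\<not> v)" for v
    proof -
      have 1: "flip X {i} x \<in> S \<longleftrightarrow> x \<in> S" if "x \<in> extensional X" for x
        using flip_finite_mem_iff[OF id, of "{i}"] J that by (simp add: mem S_def[symmetric])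
      have 2: "flip X {i} x \<in> b J A \<longleftrightarrow> x \<in> b J A" if "x \<in> extensional X" for x
      proof -
        have "flip X {i} x j = x j" if "j \<in> J" for j using that J by (auto simp: flip_def)
        with that show ?thesis by (simp add: b_def)
      qed
      have 3: "flip X {i} x i = (\<not> x i)" for x using J(3) by (simp add: flip_def)
      show ?thesis
      proof (rule set_eqI)
        fix x
        show "x \<in> flip X {i} -` ?c v \<inter> extensional X \<longleftrightarrow> x \<in> ?c (\<not> v)"
        proof (cases "x \<in> extensional X")
          case True
          then show ?thesis by (auto simp: 1 2 3)
        qed (simp add: mem)
      qed
    qed
    have eq: "measure C (?c True) = measure C (?c False)"
      using pres(2)[OF cC[of True], of "{i}"] sw[of True] by simp
    have "measure C (S \<inter> b J A) = measure C (?c True \<union> ?c False)"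
      by (rule arg_cong[of _ _ "measure C"]) auto
    also have "\<dots> = measure C (?c True) + measure C (?c False)"
      by (rule C.finite_measure_Union[OF cC cC]) auto
    finally have "measure C (S \<inter> b J A) = measure C (?c True) + measure C (?c False)" .
    then have c: "measure C (?c v) = measure C (S \<inter> b J A) / 2" for v
      using eq by (cases v) auto
    have un: "S \<inter> b (insert i J) A = (\<Union>v\<in>A i. ?c v)" by (auto simp: b_def)
    have "measure C (S \<inter> b (insert i J) A) = (\<Sum>v\<in>A i. measure C (?c v))"
      unfolding un using cC by (intro C.finite_measure_finite_Union) (auto simp: disjoint_family_on_def)
    also have "\<dots> = card (A i) / 2 * measure C (S \<inter> b J A)" by (simp only: c) simp
    finally show ?case using insert J by simp
  qed
  \<comment> \<open>The trace of the completed measure on \<open>S\<close>, brought back to the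
    sigma-algebra of \<open>M\<close> by the identity map so that uniqueness from boxes
    applies.\<close>
  define P where "P = distr (density C (indicator S)) M (\<lambda>x. x)"
  have idm: "(\<lambda>x. x) \<in> density C (indicator S) \<rightarrow>\<^sub>M M"
    by (simp add: C_def measurable_completion)
  have P: "emeasure P A = ennreal (measure C (S \<inter> A))" if "A \<in> sets M" for A
  proof -
    have AC: "A \<in> sets C" using that by (simp add: C_def)
    have "A \<subseteq> extensional X" using sets.sets_into_space[OF that] by simp
    then have "emeasure P A = emeasure (density C (indicator S)) A"
      unfolding P_def using that by (subst emeasure_distr[OF idm]) (auto simp: Int_absorb2)
    also have "\<dots> = emeasure C (S \<inter> A)"
      using S AC by (subst emeasure_density) (auto simp flip: indicator_inter_arith)
    finally show ?thesis by (simp add: C.emeasure_eq_measure)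
  qed
  have "P = scale_measure (1 / 2) M"
  proof (rule measure_eqI_PiM_infinite[where I=X and M="\<lambda>_. uniform_count_measure UNIV"])
    fix J and A :: "'a \<Rightarrow> bool set" assume J: "finite J" "J \<subseteq> X"
    have "ennreal (1 / 2 * (\<Prod>i\<in>J. card (A i) / 2)) = ennreal (1/2) * ennreal (\<Prod>i\<in>J. card (A i) / 2)"
      by (rule ennreal_mult) (auto simp: prod_nonneg)
    also have "ennreal (\<Prod>i\<in>J. card (A i) / 2) = (\<Prod>i\<in>J. ennreal (card (A i) / 2))"
      by (rule prod_ennreal[symmetric]) auto
    also have "ennreal (1/2) = 1/2"
      by (metis ennreal_1 ennreal_divide_numeral zero_le_one)
    finally show "emeasure P (prod_emb X (\<lambda>_. uniform_count_measure UNIV) J (Pi\<^sub>E J A)) =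
      emeasure (scale_measure (1 / 2) M) (prod_emb X (\<lambda>_. uniform_count_measure UNIV) J (Pi\<^sub>E J A))"
      unfolding box[OF J(2)] P[OF bM[OF J]] ind[OF J]
      by (simp add: emeasure_cantor_box[OF J, folded M_def b_def] b_def M_def)
         (simp add: emeasure_cantor_box[OF J])
  next
    show "finite_measure P"
    proof (rule finite_measureI)
      have "space P = space M" by (simp add: P_def)
      then show "emeasure P (space P) \<noteq> \<infinity>" using P[OF sets.top] by simp
    qed
  qed (auto simp: P_def M_def cantor_measure_def)
  \<comment> \<open>\<open>S\<close> may be measurable only in the completion; its main part
    \<open>L\<close> has the same measure and lies in \<open>sets M\<close>, where \<open>P\<close>
    is known.\<close>
  moreover define L where "L = main_part M S"
  have L: "L \<in> sets M" "L \<subseteq> S" "measure C L = 1 / 2"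
  proof -
    show "L \<in> sets M" unfolding L_def using S by (simp add: C_def)
    show "L \<subseteq> S" unfolding L_def using main_part_null_part_Un[OF S[unfolded C_def]] by blast
    show "measure C L = 1 / 2"
      using S half \<open>L \<in> sets M\<close> by (simp add: C_def measure_def L_def)
  qed
  moreover have "S \<inter> L = L" using L by auto
  \<comment> \<open>As \<open>L\<close> lies in \<open>S\<close>, its \<open>P\<close>-measure is
    1/2; as half the measure of \<open>L\<close>, it is 1/4.\<close>
  ultimately have "ennreal (1/2) = 1/2 * emeasure M L" using P[OF L(1)] L(3) by (simp only:) simp
  also have "emeasure M L = emeasure C L" using L(1) by (simp add: C_def)
  also have "\<dots> = ennreal (1/2)" unfolding C.emeasure_eq_measure L(3) ..
  also have "(1/2 :: ennreal) = ennreal (1/2)"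
    by (metis ennreal_1 ennreal_divide_numeral zero_le_one)
  also have "ennreal (1/2) * ennreal (1/2) = ennreal (1/2 * (1/2))" by (rule ennreal_mult[symmetric]) auto
  finally show False by (subst (asm) ennreal_inj) auto
qed

section \<open>Borel ideals\<close>

lemma measurable_cantor_coordinate:
  "i \<in> X \<Longrightarrow> {x \<in> extensional X. x i = v} \<in> sets (cantor_measure X)"
proof -
  assume i: "i \<in> X"
  have "(\<lambda>x. x i) -` {v} \<inter> space (cantor_measure X) \<in> sets (cantor_measure X)"
    unfolding cantor_measure_def using i
    by (intro measurable_sets[OF measurable_component_singleton[OF i]])
       (auto simp: sets_uniform_count_measure)
  then show ?thesis by (simp add: vimage_def Int_def conj_commute)
qed

text \<open>Over a countable index type there are only countably many cylinders, so an open set is a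
  countable union of measurable ones.\<close>

lemma openin_cantor_top_measurable:
  fixes X :: "'a :: countable set"
  assumes U: "openin (cantor_top X) U"
  shows "U \<in> sets (cantor_measure X)"
proof -
  \<comment> \<open>\<open>G\<close> lists the coordinates required to be \<open>True\<close>;
    coding patterns by finite sets makes the index family \<open>K\<close> countable.\<close>
  define W where "W = (\<lambda>F G. {x \<in> extensional X. \<forall>i\<in>F. x i = (i \<in> G)})"
  define K where "K = {(F, G). finite F \<and> F \<subseteq> X \<and> finite G \<and> W F G \<subseteq> U}"
  have "U = (\<Union>(F, G)\<in>K. W F G)"
  proof
    show "U \<subseteq> (\<Union>(F, G)\<in>K. W F G)"
    proof
      fix p assume p: "p \<in> U"
      obtain F where F: "finite F" "F \<subseteq> X" "{x \<in> extensional X. \<forall>i\<in>F. x i = p i} \<subseteq> U"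
        using cantor_top_basis[OF U p] .
      let ?G = "{i \<in> F. p i}"
      have eq: "W F ?G = {x \<in> extensional X. \<forall>i\<in>F. x i = p i}" by (auto simp: W_def)
      have "(F, ?G) \<in> K" using F eq by (simp add: K_def)
      moreover have "p \<in> W F ?G" using openin_subset[OF U] p unfolding eq by auto
      ultimately show "p \<in> (\<Union>(F, G)\<in>K. W F G)" by blast
    qed
  qed (auto simp: K_def)
  moreover have "countable K"
    by (rule countable_subset[of _ "Collect finite \<times> Collect finite"])
       (auto simp: K_def countable_Collect_finite)
  moreover have "W F G \<in> sets (cantor_measure X)" if "finite F" "F \<subseteq> X" for F G
  proof -
    have "W F G = space (cantor_measure X) \<inter> (\<Inter>i\<in>F. {x \<in> extensional X. x i = (i \<in> G)})"
      by (auto simp: W_def)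
    also have "\<dots> \<in> sets (cantor_measure X)"
    proof (cases "F = {}")
      case True
      then show ?thesis using sets.top[of "cantor_measure X"] by simp
    next
      case False
      with that show ?thesis
        by (intro sets.Int sets.top sets.finite_INT measurable_cantor_coordinate) auto
    qed
    finally show ?thesis .
  qed
  ultimately show ?thesis
    by (metis (mono_tags, lifting) K_def case_prodE mem_Collect_eq prod.case sets.countable_UN'')
qed

lemma ideal_restrict_eq:
  assumes "set_ideal X \<I>"
  shows "ideal_restrict \<I> C = {A \<in> \<I>. A \<subseteq> C}"
proof -
  have 1: "A \<inter> C \<in> \<I>" if "A \<in> \<I>" for A by (rule set_idealD(2)[OF assms that Int_lower1])
  show ?thesis unfolding ideal_restrict_def
  proof (intro set_eqI iffI)
    fix B assume "B \<in> {A \<inter> C | A. A \<in> \<I>}"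
    then obtain A where "A \<in> \<I>" "B = A \<inter> C" by auto
    then show "B \<in> {A \<in> \<I>. A \<subseteq> C}" using 1[of A] by simp
  next
    fix B assume "B \<in> {A \<in> \<I>. A \<subseteq> C}"
    then show "B \<in> {A \<inter> C | A. A \<in> \<I>}" by (intro CollectI exI[of _ B]) auto
  qed
qed

lemma set_ideal_restrict:
  assumes "set_ideal X \<I>" "C \<in> coideal X \<I>"
  shows "set_ideal C (ideal_restrict \<I> C)"
proof -
  note I = set_idealD[OF assms(1)]
  have C: "C \<subseteq> X" "C \<notin> \<I>" using assms(2) by (simp_all add: coideal_def)
  show ?thesis unfolding ideal_restrict_eq[OF assms(1)] set_ideal_def
    using C I(6) by (auto intro: I(2) I(3) I(4))
qed

text \<open>Padding with \<open>False\<close> maps the Cantor space over \<open>C\<close> measurably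
  into that over \<open>X\<close>, and the restricted ideal is the preimage of \<I> under this
  map.\<close>

lemma borel_imp_lebesgue_restrict:
  fixes X :: "'a :: countable set"
  assumes I: "set_ideal X \<I>" and "borel_family X \<I>" and C: "C \<in> coideal X \<I>"
  shows "lebesgue_family C (ideal_restrict \<I> C)"
proof -
  have CX: "C \<subseteq> X" using C by (simp add: coideal_def)
  have "sigma_sets (topspace (cantor_top X)) {U. openin (cantor_top X) U} \<subseteq> sets (cantor_measure X)"
    using sets.sigma_sets_subset[of "{U. openin (cantor_top X) U}" "cantor_measure X"]
      openin_cantor_top_measurable[of X]
    by (simp add: subset_eq)
  with assms have B: "char_fun X ` \<I> \<in> sets (cantor_measure X)"
    by (auto simp: borel_family_def borel_sets_of_def)
  define e where "e = (\<lambda>x. \<lambda>i\<in>X. i \<in> C \<and> x i)"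
  have e: "e \<in> cantor_measure C \<rightarrow>\<^sub>M cantor_measure X"
  proof -
    have "e \<in> cantor_measure C \<rightarrow>\<^sub>M Pi\<^sub>M X (\<lambda>_. uniform_count_measure UNIV)"
    proof (rule measurable_PiM_single')
      show "e \<in> space (cantor_measure C) \<rightarrow> (\<Pi>\<^sub>E i\<in>X. space (uniform_count_measure UNIV))"
        by (auto simp: e_def space_uniform_count_measure)
      fix i assume i: "i \<in> X"
      show "(\<lambda>x. e x i) \<in> cantor_measure C \<rightarrow>\<^sub>M uniform_count_measure UNIV"
      proof (cases "i \<in> C")
        case True
        then show ?thesis using i unfolding cantor_measure_def
          by (simp add: e_def measurable_component_singleton)
      next
        case False
        then show ?thesis using i
          by (simp add: e_def space_uniform_count_measure)
      qed
    qed
    then show ?thesis by (simp add: cantor_measure_def)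
  qed
  have "char_fun C ` ideal_restrict \<I> C = e -` (char_fun X ` \<I>) \<inter> space (cantor_measure C)"
  proof -
    have "{i \<in> X. e x i} = {i \<in> C. x i}" for x using CX by (auto simp: e_def)
    moreover have "e x \<in> extensional X" for x by (simp add: e_def)
    moreover note mem_char_fun_image_iff[OF set_idealD(1)[OF set_ideal_restrict[OF I C]]]
      mem_char_fun_image_iff[OF set_idealD(1)[OF I]]
    ultimately show ?thesis
      unfolding set_eq_iff Int_iff vimage_eq space_cantor_measure
      by (simp add: ideal_restrict_eq[OF I] conj_commute) blast
  qed
  also have "\<dots> \<in> sets (cantor_measure C)" by (rule measurable_sets[OF e B])
  finally show ?thesis by (simp add: lebesgue_family_def)
qed

section \<open>Splitting coideal sets\<close>

text \<open>Split off one piece and go on with the remainder, which stays outside the ideal; later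
  pieces lie in that remainder and so avoid the earlier ones.\<close>

lemma disjoint_coideal_sequence:
  assumes split: "\<And>C. C \<in> coideal X \<I> \<Longrightarrow> \<exists>A\<subseteq>C. A \<notin> \<I> \<and> C - A \<notin> \<I>"
    and C: "C \<in> coideal X \<I>"
  obtains D :: "nat \<Rightarrow> 'a set" where "disjoint_family D" "\<And>i. D i \<subseteq> C" "\<And>i. D i \<notin> \<I>"
proof -
  obtain f where f: "\<And>C. C \<in> coideal X \<I> \<Longrightarrow> f C \<subseteq> C \<and> f C \<notin> \<I> \<and> C - f C \<notin> \<I>"
    using split by metis
  \<comment> \<open>\<open>R n\<close> is what is left after removing \<open>n\<close> pieces; the
    pieces are the sets \<open>f (R n)\<close>.\<close>
  define R where "R = rec_nat C (\<lambda>_ A. A - f A)"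
  have R_simps: "R 0 = C" "R (Suc n) = R n - f (R n)" for n by (simp_all add: R_def)
  have R: "R n \<in> coideal X \<I>" for n
    using C f by (induction n) (auto simp: R_simps coideal_def)
  have dec: "R n \<subseteq> R m" if "m \<le> n" for m n
    using that by (rule lift_Suc_antimono_le[rotated]) (auto simp: R_simps)
  have disj: "f (R m) \<inter> f (R n) = {}" if "m < n" for m n
    using dec[of "Suc m" n] that f[OF R[of n]] by (auto simp: R_simps)
  have "disjoint_family (\<lambda>n. f (R n))"
    unfolding disjoint_family_on_def using disj by (metis Int_commute linorder_neqE_nat)
  moreover have "f (R n) \<subseteq> C" for n using f[OF R[of n]] dec[of 0 n] by (auto simp: R_simps)
  ultimately show ?thesis using f[OF R] by (intro that[of "\<lambda>n. f (R n)"]) auto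
qed

text \<open>If \<open>C\<close> could not be split, the restriction to \<open>C\<close> would be a
  maximal ideal there, which neither regularity property allows.\<close>

lemma hereditary_split:
  assumes I: "set_ideal X \<I>" and H: "hereditary_baire X \<I> \<or> hereditary_lebesgue X \<I>"
    and C: "C \<in> coideal X \<I>"
  shows "\<exists>A\<subseteq>C. A \<notin> \<I> \<and> C - A \<notin> \<I>"
proof (rule ccontr)
  assume "\<not> ?thesis"
  then have "\<forall>A\<subseteq>C. A \<in> ideal_restrict \<I> C \<or> C - A \<in> ideal_restrict \<I> C"
    unfolding ideal_restrict_eq[OF I] by blast
  with set_ideal_restrict[OF I C] have max: "maximal_set_ideal C (ideal_restrict \<I> C)"
    by (simp add: maximal_set_ideal_def)
  show False
    using H C maximal_set_ideal_not_baire[OF max] maximal_set_ideal_not_lebesgue[OF max]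
    unfolding hereditary_baire_def hereditary_lebesgue_def by blast
qed

section \<open>Sequences\<close>

lemma ell1_nth_simps [simp]:
  "ell1_nth 0 n = 0" "ell1_nth (a + b) n = ell1_nth a n + ell1_nth b n"
  "ell1_nth (c *\<^sub>R a) n = c * ell1_nth a n"
  by (simp_all add: zero_ell1.rep_eq plus_ell1.rep_eq scaleR_ell1.rep_eq)

lemma ell1_nth_sum: "ell1_nth (\<Sum>x\<in>T. f x) n = (\<Sum>x\<in>T. ell1_nth (f x) n)"
  by (induction T rule: infinite_finite_induct) auto

lemma abs_ell1_nth_le_norm: "\<bar>ell1_nth a n\<bar> \<le> norm a"
  using sum_le_suminf[OF ell1_summable, of "{n}" a] by (simp add: norm_ell1.rep_eq)

lemma bounded_linear_ell1_nth: "bounded_linear (\<lambda>a. ell1_nth a n)"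
  by (rule bounded_linear_intro[of _ 1]) (auto simp: abs_ell1_nth_le_norm)

section \<open>Lineability and spaceability: monotonicity and the empty set\<close>

lemma lineable_mono: "Y \<subseteq> Z \<Longrightarrow> lineable K Y \<Longrightarrow> lineable K Z"
  unfolding lineable_def by blast

lemma spaceable_mono: "Y \<subseteq> Z \<Longrightarrow> spaceable Y \<Longrightarrow> spaceable Z"
  unfolding spaceable_def by blast

lemma not_lineable_empty: "K \<noteq> {} \<Longrightarrow> \<not> lineable K {}"
proof
  assume K: "K \<noteq> {}" and "lineable K ({} :: 'b set)"
  then obtain V B where B: "V \<subseteq> {0 :: 'b}" "independent B" "span B = V" "B \<approx> K"
    by (auto simp: lineable_def)
  have "B \<subseteq> {0}" using span_superset[of B] B by auto
  then have "B = {}" using B(2) dependent_zero[of B] by auto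
  then show False using B(4) K by (auto dest: eqpoll_sym)
qed

lemma not_spaceable_empty: "\<not> spaceable {}"
proof
  assume "spaceable ({} :: 'a set)"
  then obtain V where V: "subspace V" "V \<subseteq> {0 :: 'a}" "\<And>B. finite B \<Longrightarrow> span B \<noteq> V"
    by (auto simp: spaceable_def)
  have "V = {0}" using V(1,2) subspace_0 by auto
  then show False using V(3)[of "{}"] by simp
qed

section \<open>Convergence along the ideal and along its dual filter\<close>

lemma infinite_Diff_set_ideal:
  assumes "set_ideal X \<I>" "A \<in> \<I>"
  shows "infinite (X - A)"
proof
  note I = set_idealD[OF assms(1)]
  assume "finite (X - A)"
  then have "X - A \<in> \<I>" by (rule I(4)) auto
  then have "A \<union> (X - A) \<in> \<I>" by (rule I(3)[OF assms(2)])
  moreover have "A \<union> (X - A) = X" using assms(2) I(1) by blast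
  ultimately show False using I(5) by simp
qed

text \<open>Terms of size at least \<epsilon> sit in the excluded set \<open>A\<close> or among
  finitely many initial terms of the enumeration.\<close>

lemma dual_conv_zero_imp_ideal_conv_zero:
  assumes I: "set_ideal {1..} \<I>" and "dual_conv_zero \<I> x"
  shows "ideal_conv_zero \<I> x"
  unfolding ideal_conv_zero_def
proof (intro allI impI)
  fix \<epsilon> :: real assume "\<epsilon> > 0"
  note I' = set_idealD[OF I]
  obtain A where A: "A \<in> \<I>" and lim: "(\<lambda>k. x (enumerate ({1..} - A) k)) \<longlonglongrightarrow> 0"
    using assms(2) by (auto simp: dual_conv_zero_def dual_filter_def)
  let ?F = "{1..} - A"
  \<comment> \<open>Infinity ensures that \<open>enumerate\<close> runs through all of
    \<open>?F\<close>.\<close>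
  note inf = infinite_Diff_set_ideal[OF I A]
  obtain K where K: "\<And>k. k \<ge> K \<Longrightarrow> \<bar>x (enumerate ?F k)\<bar> < \<epsilon>"
    using LIMSEQ_D[OF lim \<open>\<epsilon> > 0\<close>] by auto
  have "{n \<in> {1..}. \<epsilon> \<le> \<bar>x n\<bar>} \<subseteq> A \<union> enumerate ?F ` {..<K}"
  proof
    fix n assume n: "n \<in> {n \<in> {1..}. \<epsilon> \<le> \<bar>x n\<bar>}"
    show "n \<in> A \<union> enumerate ?F ` {..<K}"
    proof (cases "n \<in> A")
      case False
      then have "n \<in> range (enumerate ?F)" unfolding range_enumerate[OF inf] using n by simp
      then obtain k where "enumerate ?F k = n" by auto
      then show ?thesis using n K[of k] by (cases "k < K") auto
    qed auto
  qed
  moreover have "enumerate ?F ` {..<K} \<in> \<I>"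
    by (rule I'(4)) (use enumerate_in_set[OF inf] in auto)
  ultimately show "{n \<in> {1..}. \<epsilon> \<le> \<bar>x n\<bar>} \<in> \<I>" by (meson I'(2) I'(3)[OF A])
qed

lemma AOS_ideal_subset_AOS_dual: "set_ideal {1..} \<I> \<Longrightarrow> AOS_ideal \<I> \<subseteq> AOS_dual \<I>"
  by (auto simp: AOS_ideal_def AOS_dual_def dual_conv_zero_imp_ideal_conv_zero)

text \<open>With tails \<open>r n = (\<Sum>k. \<bar>a (n + k)\<bar>)\<close>, the estimate
  \<open>\<bar>a n\<bar> / sqrt (r n) \<le> 2 * (sqrt (r n) - sqrt (r (Suc n)))\<close> makes the left-hand side summable.\<close>

lemma olivier_exceptional_set:
  fixes a :: "nat \<Rightarrow> real"
  assumes a: "summable (\<lambda>n. \<bar>a n\<bar>)"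
  obtains A where "A \<in> summable_ideal" "\<And>\<epsilon>. \<epsilon> > 0 \<Longrightarrow> \<forall>\<^sub>F n in sequentially. n \<notin> A \<longrightarrow> \<bar>real n * a n\<bar> < \<epsilon>"
proof -
  define r where "r n = (\<Sum>k. \<bar>a (k + n)\<bar>)" for n
  have sm: "summable (\<lambda>k. \<bar>a (k + n)\<bar>)" for n using summable_ignore_initial_segment[OF a] .
  have r_Suc: "r n = \<bar>a n\<bar> + r (Suc n)" for n
    using suminf_split_head[OF sm[of n]] by (simp add: r_def)
  have r_nonneg: "r n \<ge> 0" for n unfolding r_def by (rule suminf_nonneg[OF sm]) simp
  have "r \<longlonglongrightarrow> 0" unfolding r_def using suminf_exist_split2[OF a] .
  then have lim: "(\<lambda>n. sqrt (r n)) \<longlonglongrightarrow> 0" using tendsto_real_sqrt by fastforce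
  \<comment> \<open>The threshold \<open>sqrt (r n)\<close> serves both aims: it tends to zero,
    which controls the terms off \<open>A\<close>, and on \<open>A\<close> it gives
    \<open>1 / n < \<bar>a n\<bar> / sqrt (r n)\<close>.\<close>
  define A where "A = {n \<in> {1..}. real n * \<bar>a n\<bar> > sqrt (r n)}"
  have le: "\<bar>a n\<bar> / sqrt (r n) \<le> 2 * (sqrt (r n) - sqrt (r (Suc n)))" for n
  proof (cases "r n = 0")
    \<comment> \<open>Both sides vanish, the left one by the convention for division by
      zero.\<close>
    case True
    then have "r (Suc n) = 0" using r_Suc[of n] r_nonneg[of "Suc n"] by auto
    with True show ?thesis by simp
  next
    case False
    let ?s = "sqrt (r n)" and ?t = "sqrt (r (Suc n))"
    have s: "?s > 0" using False r_nonneg[of n] by simp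
    have ts: "?t \<le> ?s" using r_Suc[of n] by simp
    have "\<bar>a n\<bar> = ?s\<^sup>2 - ?t\<^sup>2" using r_Suc[of n] r_nonneg by simp
    also have "\<dots> = (?s - ?t) * (?s + ?t)" by (simp add: power2_eq_square algebra_simps)
    also have "\<dots> \<le> (?s - ?t) * (2 * ?s)" using ts by (intro mult_left_mono) auto
    finally show ?thesis using s by (simp add: field_simps)
  qed
  have "summable (\<lambda>n. sqrt (r n) - sqrt (r (Suc n)))"
    using telescope_summable'[OF lim] .
  then have "summable (\<lambda>n. 2 * (sqrt (r n) - sqrt (r (Suc n))))" by (rule summable_mult)
  then have "summable (\<lambda>n. \<bar>a n\<bar> / sqrt (r n))"
    by (rule summable_comparison_test'[where N=0]) (simp add: le r_nonneg del: right_diff_distrib_numeral)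
  then have "(\<lambda>n. \<bar>a n\<bar> / sqrt (r n)) summable_on UNIV"
    by (subst summable_on_UNIV_nonneg_real_iff) (auto simp: r_nonneg)
  then have "(\<lambda>n. \<bar>a n\<bar> / sqrt (r n)) summable_on A"
    by (rule summable_on_subset_banach) auto
  then have "(\<lambda>n. 1 / real n) summable_on A"
  proof (rule summable_on_comparison_test)
    fix n assume n: "n \<in> A"
    then have n1: "n \<ge> 1" and n2: "real n * \<bar>a n\<bar> > sqrt (r n)" by (auto simp: A_def)
    have "a n \<noteq> 0" using n2 r_nonneg[of n] by auto
    then have "r n > 0" using r_Suc[of n] r_nonneg[of "Suc n"] by auto
    then show "1 / real n \<le> \<bar>a n\<bar> / sqrt (r n)" using n1 n2 by (simp add: field_simps)
  qed auto
  then have "A \<in> summable_ideal" by (auto simp: summable_ideal_def A_def)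
  moreover have "\<forall>\<^sub>F n in sequentially. n \<notin> A \<longrightarrow> \<bar>real n * a n\<bar> < \<epsilon>" if "\<epsilon> > 0" for \<epsilon>
    using order_tendstoD(2)[OF lim that] eventually_ge_at_top[of 1]
    by eventually_elim (auto simp: A_def abs_mult)
  ultimately show ?thesis using that by blast
qed

text \<open>A form of Olivier's theorem: the exceptional set of a sequence belongs to the ideal, so
  \<open>n * a n\<close> tends to zero along its complement. The contrapositive yields a summable
  set outside the ideal.\<close>

lemma AOS_dual_empty:
  assumes I: "set_ideal {1..} \<I>" and sub: "summable_ideal \<subseteq> \<I>"
  shows "AOS_dual \<I> = {}"
proof -
  have "dual_conv_zero \<I> (\<lambda>n. real n * ell1_nth a n)" for a
  proof -
    obtain A where A: "A \<in> summable_ideal"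
      and ev: "\<And>\<epsilon>. \<epsilon> > 0 \<Longrightarrow> \<forall>\<^sub>F n in sequentially. n \<notin> A \<longrightarrow> \<bar>real n * ell1_nth a n\<bar> < \<epsilon>"
      using olivier_exceptional_set[OF ell1_summable[of a]] by blast
    let ?F = "{1..} - A"
    have AI: "A \<in> \<I>" using A sub by auto
    note inf = infinite_Diff_set_ideal[OF I AI]
    have "(\<lambda>k. real (enumerate ?F k) * ell1_nth a (enumerate ?F k)) \<longlonglongrightarrow> 0"
    proof (rule LIMSEQ_I)
      fix \<epsilon> :: real assume "\<epsilon> > 0"
      then obtain N where N: "\<And>n. n \<ge> N \<Longrightarrow> n \<notin> A \<Longrightarrow> \<bar>real n * ell1_nth a n\<bar> < \<epsilon>"
        using ev by (auto simp: eventually_sequentially)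
      have "\<bar>real (enumerate ?F k) * ell1_nth a (enumerate ?F k)\<bar> < \<epsilon>" if "k \<ge> N" for k
        using N le_trans[OF that le_enumerate[OF inf]] enumerate_in_set[OF inf, of k] by auto
      then show "\<exists>no. \<forall>k\<ge>no. norm (real (enumerate ?F k) * ell1_nth a (enumerate ?F k) - 0) < \<epsilon>"
        by auto
    qed
    then show ?thesis using AI by (auto simp: dual_conv_zero_def dual_filter_def)
  qed
  then show ?thesis by (auto simp: AOS_dual_def)
qed

section \<open>A closed subspace from disjoint coideal sets\<close>

text \<open>Vandermonde independence: by linearity the powers may be replaced by any polynomial, and
  the one with root set \<open>T - {s}\<close> isolates \<open>c s\<close>.\<close>

lemma power_sums_zero_imp_zero:
  fixes c :: "real \<Rightarrow> real"
  assumes T: "finite T" and 0: "\<And>i. (\<Sum>r\<in>T. c r * r ^ i) = 0" and s: "s \<in> T"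
  shows "c s = 0"
proof -
  have poly: "(\<Sum>r\<in>T. c r * poly p r) = 0" for p
  proof -
    have "(\<Sum>r\<in>T. c r * poly p r) = (\<Sum>i\<le>degree p. coeff p i * (\<Sum>r\<in>T. c r * r ^ i))"
      unfolding poly_altdef sum_distrib_left
      by (subst sum.swap) (simp add: mult_ac)
    then show ?thesis by (simp add: 0)
  qed
  let ?p = "\<Prod>t\<in>T - {s}. [:- t, 1:]"
  have "poly ?p r = 0" if "r \<in> T - {s}" for r
    using T that by (auto simp: poly_prod)
  then have "(\<Sum>r\<in>T. c r * poly ?p r) = c s * poly ?p s"
    using T s by (subst sum.remove[of _ s]) (auto intro!: sum.neutral)
  moreover have "poly ?p s \<noteq> 0" using T by (auto simp: poly_prod)
  ultimately show ?thesis using poly[of ?p] by simp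
qed

text \<open>Constancy of \<open>n * a n\<close> on each block is written without naming the
  constants, so that only linear equations between coordinates occur.\<close>

definition block_space :: "(nat \<Rightarrow> nat set) \<Rightarrow> ell1 set" where
  "block_space D = {a. (\<forall>n. n \<notin> (\<Union>i. D i) \<longrightarrow> ell1_nth a n = 0) \<and>
     (\<forall>i. \<forall>m\<in>D i. \<forall>n\<in>D i. real m * ell1_nth a m = real n * ell1_nth a n)}"

lemma block_spaceD:
  assumes "a \<in> block_space D"
  shows "n \<notin> (\<Union>i. D i) \<Longrightarrow> ell1_nth a n = 0"
    and "m \<in> D i \<Longrightarrow> n \<in> D i \<Longrightarrow> real m * ell1_nth a m = real n * ell1_nth a n"
  using assms unfolding block_space_def by fast+

lemma subspace_block_space: "subspace (block_space D)"
proof (rule subspaceI)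
  fix a b assume a: "a \<in> block_space D" and b: "b \<in> block_space D"
  have "real m * ell1_nth (a + b) m = real n * ell1_nth (a + b) n" if "m \<in> D i" "n \<in> D i" for i m n
    using block_spaceD(2)[OF a that] block_spaceD(2)[OF b that] by (simp add: distrib_left)
  moreover have "ell1_nth (a + b) n = 0" if "n \<notin> (\<Union>i. D i)" for n
    using block_spaceD(1)[OF a that] block_spaceD(1)[OF b that] by simp
  ultimately show "a + b \<in> block_space D" unfolding block_space_def by fast
next
  fix c a assume a: "a \<in> block_space D"
  have "real m * ell1_nth (c *\<^sub>R a) m = real n * ell1_nth (c *\<^sub>R a) n" if "m \<in> D i" "n \<in> D i" for i m n
    using arg_cong[OF block_spaceD(2)[OF a that], of "\<lambda>t. c * t"] by (simp add: mult.left_commute)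
  moreover have "ell1_nth (c *\<^sub>R a) n = 0" if "n \<notin> (\<Union>i. D i)" for n
    using block_spaceD(1)[OF a that] by simp
  ultimately show "c *\<^sub>R a \<in> block_space D" unfolding block_space_def by fast
qed (simp add: block_space_def)

text \<open>Coordinates are continuous on \<open>ell1\<close>, so each defining equation cuts out a
  closed set.\<close>

lemma closed_block_space: "closed (block_space D)"
proof -
  note cont = continuous_intros bounded_linear.continuous_on[OF bounded_linear_ell1_nth]
  have "block_space D = (\<Inter>n\<in>-(\<Union>i. D i). {a. ell1_nth a n = 0}) \<inter>
      (\<Inter>i. \<Inter>m\<in>D i. \<Inter>n\<in>D i. {a. real m * ell1_nth a m = real n * ell1_nth a n})"
    by (auto simp: block_space_def)
  also have "closed \<dots>"
    by (intro closed_Int closed_INT ballI closed_Collect_eq cont)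
  finally show ?thesis .
qed

text \<open>A nonzero member has a nonzero constant on some block \<open>D i\<close>; taking its
  absolute value as \<epsilon>, the set of large terms contains \<open>D i\<close> and cannot be in
  the ideal.\<close>

lemma block_space_subset_AOS:
  assumes I: "set_ideal {1..} \<I>" and D: "\<And>i. D i \<subseteq> {1..}" "\<And>i. D i \<notin> \<I>"
  shows "block_space D \<subseteq> AOS_ideal \<I> \<union> {0}"
proof
  fix a assume a: "a \<in> block_space D"
  show "a \<in> AOS_ideal \<I> \<union> {0}"
  proof (cases "a = 0")
    case False
    then have "ell1_nth a \<noteq> ell1_nth 0" by (simp add: ell1_nth_inject)
    then obtain n where n: "ell1_nth a n \<noteq> 0" by (auto simp: fun_eq_iff)
    with block_spaceD(1)[OF a, of n] obtain i where i: "n \<in> D i" by auto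
    let ?e = "\<bar>real n * ell1_nth a n\<bar>"
    have "?e > 0" using n i D(1)[of i] by auto
    have eq: "real m * ell1_nth a m = real n * ell1_nth a n" if "m \<in> D i" for m
      by (rule block_spaceD(2)[OF a that i])
    have "D i \<subseteq> {m \<in> {1..}. ?e \<le> \<bar>real m * ell1_nth a m\<bar>}"
      using D(1)[of i] by (auto simp: eq)
    then have "{m \<in> {1..}. ?e \<le> \<bar>real m * ell1_nth a m\<bar>} \<notin> \<I>"
      using set_idealD(2)[OF I] D(2)[of i] by blast
    with \<open>?e > 0\<close> show ?thesis unfolding AOS_ideal_def ideal_conv_zero_def by blast
  qed auto
qed

text \<open>For each \<open>r\<close> between 0 and 1 take the member whose constants on the blocks
  are the powers \<open>r ^ i\<close>; distinct values of \<open>r\<close> give independent vectors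
  by the Vandermonde argument.\<close>

lemma block_space_large:
  assumes D: "disjoint_family D" "\<And>i. D i \<subseteq> {1..}" "\<And>i. D i \<noteq> {}"
    and sum: "(\<lambda>n. 1 / real n) summable_on (\<Union>i. D i)"
  obtains B where "independent B" "B \<subseteq> block_space D" "B \<approx> (UNIV :: real set)"
proof -
  \<comment> \<open>Meaningful only on the union of the blocks; \<open>g\<close> takes the value 0
    elsewhere.\<close>
  define idx where "idx n = (THE i. n \<in> D i)" for n
  have idx: "idx n = i" if "n \<in> D i" for n i
    unfolding idx_def using that D(1)
    by (intro the_equality) (auto simp: disjoint_family_on_def)
  define g where "g r n = (if n \<in> (\<Union>i. D i) then r ^ idx n / real n else 0)" for r :: real and n
  have gD: "g r n = r ^ i / real n" if "n \<in> D i" for r n i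
    using that idx[OF that] by (auto simp: g_def)
  have "summable (\<lambda>n. \<bar>g r n\<bar>)" if r: "0 < r" "r < 1" for r
  proof -
    have "(\<lambda>n. \<bar>g r n\<bar>) summable_on (\<Union>i. D i)"
      using sum
    proof (rule summable_on_comparison_test)
      fix n assume "n \<in> (\<Union>i. D i)"
      then obtain i where i: "n \<in> D i" by auto
      have "r ^ i \<le> 1" using r by (simp add: power_le_one)
      then show "\<bar>g r n\<bar> \<le> 1 / real n" using r by (simp add: gD[OF i] divide_right_mono)
    qed auto
    then have "(\<lambda>n. \<bar>g r n\<bar>) summable_on UNIV"
      by (rule summable_on_cong_neutral[THEN iffD1, rotated -1]) (auto simp: g_def)
    then show ?thesis by (subst (asm) summable_on_UNIV_nonneg_real_iff) auto
  qed
  moreover have "g r 0 = 0" for r by (simp add: g_def)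
  ultimately have nth: "ell1_nth (Abs_ell1 (g r)) = g r" if "0 < r" "r < 1" for r
    using that by (intro Abs_ell1_inverse) auto
  define R where "R = {0<..<1::real}"
  let ?v = "\<lambda>r. Abs_ell1 (g r)"
  have in_V: "?v r \<in> block_space D" if "r \<in> R" for r
  proof -
    have "real m * g r m = r ^ i" if "m \<in> D i" for i m
      using that D(2)[of i] gD[OF that, of r] by auto
    with that show ?thesis by (simp add: block_space_def nth R_def) (auto simp: g_def)
  qed
  \<comment> \<open>One coordinate in block \<open>i\<close> reads off \<open>r ^ i\<close> up to a
    factor that is the same for all \<open>r\<close>.\<close>
  have at: "\<exists>n. \<forall>r\<in>R. ell1_nth (?v r) n = r ^ i / real n \<and> real n > 0" for i
  proof -
    obtain n where "n \<in> D i" using D(3)[of i] by auto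
    then show ?thesis using D(2)[of i] by (intro exI[of _ n]) (auto simp: nth R_def gD)
  qed
  have inj: "inj_on ?v R"
  proof
    fix r s assume rs: "r \<in> R" "s \<in> R" "?v r = ?v s"
    obtain n where n: "\<forall>r\<in>R. ell1_nth (?v r) n = r ^ 1 / real n \<and> real n > 0"
      using at[of 1] by blast
    then have "r / real n = s / real n" using rs by (metis power_one_right)
    then show "r = s" using n rs by auto
  qed
  have "independent (?v ` R)"
  proof
    assume "dependent (?v ` R)"
    then obtain S u x where S: "finite S" "S \<subseteq> ?v ` R" and 0: "(\<Sum>v\<in>S. u v *\<^sub>R v) = 0"
      and x: "x \<in> S" "u x \<noteq> 0"
      unfolding dependent_explicit by auto
    obtain T where T: "T \<subseteq> R" "finite T" "S = ?v ` T"
      using finite_subset_image[OF S] by blast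
    have injT: "inj_on ?v T" using inj T(1) by (rule inj_on_subset)
    have "(\<Sum>r\<in>T. u (?v r) * r ^ i) = 0" for i
    proof -
      obtain n where n: "\<forall>r\<in>R. ell1_nth (?v r) n = r ^ i / real n \<and> real n > 0"
        using at by blast
      have "0 = ell1_nth (\<Sum>v\<in>S. u v *\<^sub>R v) n" by (simp add: 0)
      also have "\<dots> = (\<Sum>r\<in>T. u (?v r) * (r ^ i / real n))"
        unfolding ell1_nth_sum T(3) sum.reindex[OF injT] using n T(1)
        by (intro sum.cong) (auto simp: subset_iff)
      also have "\<dots> = (\<Sum>r\<in>T. u (?v r) * r ^ i) / real n" by (simp add: sum_divide_distrib)
      \<comment> \<open>\<open>x\<close> supplies an element of \<open>R\<close>, from which
        positivity of \<open>n\<close> can be read off in the bounded quantifier.\<close>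
      finally show ?thesis using n x T by auto
    qed
    then have "u (?v r) = 0" if "r \<in> T" for r
      using power_sums_zero_imp_zero[OF T(2), of "\<lambda>r. u (?v r)"] that by blast
    then show False using x T(3) by auto
  qed
  moreover have "?v ` R \<approx> (UNIV :: real set)"
  proof -
    have "?v ` R \<approx> R" using inj by (simp add: inj_on_image_eqpoll_self)
    also have "R \<approx> (UNIV :: real set)"
      unfolding eqpoll_def
    \<comment> \<open>A logit-type bijection of the unit interval onto the reals; its inverse is a
      logistic function.\<close>
    proof (intro exI[of _ "\<lambda>r. ln (1 / r - 1)"] bij_betw_byWitness[where f'="\<lambda>s. 1 / (1 + exp s)"])
      show "\<forall>r\<in>R. 1 / (1 + exp (ln (1 / r - 1))) = r" by (auto simp: R_def field_simps)
    qed (auto simp: R_def field_simps add_pos_pos)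
    finally show ?thesis .
  qed
  ultimately show ?thesis using in_V by (intro that[of "?v ` R"]) auto
qed

text \<open>Splitting a summable set outside the ideal gives the blocks. Their
  \<open>block_space\<close> witnesses spaceability, and the span of its large independent set
  witnesses lineability.\<close>

lemma AOS_ideal_large:
  assumes I: "set_ideal {1..} \<I>"
    and split: "\<And>C. C \<in> coideal {1..} \<I> \<Longrightarrow> \<exists>A\<subseteq>C. A \<notin> \<I> \<and> C - A \<notin> \<I>"
    and ne: "summable_ideal \<inter> coideal {1..} \<I> \<noteq> {}"
  shows "lineable (UNIV :: real set) (AOS_ideal \<I>)" "spaceable (AOS_ideal \<I>)"
proof -
  obtain C where C: "C \<in> summable_ideal" "C \<in> coideal {1..} \<I>" using ne by auto
  obtain D :: "nat \<Rightarrow> nat set" where D: "disjoint_family D" "\<And>i. D i \<subseteq> C" "\<And>i. D i \<notin> \<I>"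
    using disjoint_coideal_sequence[OF split C(2)] by blast
  have D1: "D i \<subseteq> {1..}" for i using D(2)[of i] C(2) by (auto simp: coideal_def)
  have D2: "D i \<noteq> {}" for i using D(3)[of i] set_idealD(6)[OF I] by auto
  have "(\<lambda>n. 1 / real n) summable_on C" using C(1) by (simp add: summable_ideal_def)
  then have sm: "(\<lambda>n. 1 / real n) summable_on (\<Union>i. D i)"
    by (rule summable_on_subset_banach) (use D(2) in auto)
  obtain B where B: "independent B" "B \<subseteq> block_space D" "B \<approx> (UNIV :: real set)"
    using block_space_large[OF D(1) D1 D2 sm] .
  note V = subspace_block_space[of D] closed_block_space[of D] block_space_subset_AOS[of \<I> D, OF I D1 D(3)]
  have "span B \<subseteq> AOS_ideal \<I> \<union> {0}" using span_minimal[OF B(2) V(1)] V(3) by blast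
  then show "lineable (UNIV :: real set) (AOS_ideal \<I>)"
    unfolding lineable_def using B by (intro exI[of _ "span B"] exI[of _ B]) auto
  have "infinite B" using eqpoll_finite_iff[OF B(3)] infinite_UNIV_char_0 by blast
  \<comment> \<open>A finite spanning set would bound the size of every independent subset.\<close>
  then have "span S \<noteq> block_space D" if "finite S" for S
    using independent_span_bound[OF that B(1)] B(2) by blast
  then show "spaceable (AOS_ideal \<I>)"
    unfolding spaceable_def using V by (intro exI[of _ "block_space D"]) blast
qed

section \<open>The equivalence of the seven conditions\<close>

theorem theorem4p5:
  fixes \<I> :: "nat set set"
  assumes "set_ideal {1..} \<I>"
  shows "(borel_family {1..} \<I> \<longrightarrow> hereditary_baire {1..} \<I> \<or> hereditary_lebesgue {1..} \<I>) \<and>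
    (hereditary_baire {1..} \<I> \<or> hereditary_lebesgue {1..} \<I> \<longrightarrow>
      (AOS_ideal \<I> \<noteq> {} \<longleftrightarrow> AOS_dual \<I> \<noteq> {}) \<and>
      (AOS_dual \<I> \<noteq> {} \<longleftrightarrow> lineable (UNIV :: real set) (AOS_ideal \<I>)) \<and>
      (lineable (UNIV :: real set) (AOS_ideal \<I>) \<longleftrightarrow> lineable (UNIV :: real set) (AOS_dual \<I>)) \<and>
      (lineable (UNIV :: real set) (AOS_dual \<I>) \<longleftrightarrow> spaceable (AOS_ideal \<I>)) \<and>
      (spaceable (AOS_ideal \<I>) \<longleftrightarrow> spaceable (AOS_dual \<I>)) \<and>
      (spaceable (AOS_dual \<I>) \<longleftrightarrow> summable_ideal \<inter> coideal {1..} \<I> \<noteq> {}))"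
proof (intro conjI impI)
  \<comment> \<open>Borel ideals are covered through the measurable alternative.\<close>
  assume "borel_family {1..} \<I>"
  then show "hereditary_baire {1..} \<I> \<or> hereditary_lebesgue {1..} \<I>"
    using borel_imp_lebesgue_restrict[OF assms] by (simp add: hereditary_lebesgue_def)
next
  assume H: "hereditary_baire {1..} \<I> \<or> hereditary_lebesgue {1..} \<I>"
  note large = AOS_ideal_large[OF assms hereditary_split[OF assms H]]
  note sub = AOS_ideal_subset_AOS_dual[OF assms]
  \<comment> \<open>The hub of the equivalences: every other condition is compared with
    \<open>?P\<close>.\<close>
  let ?P = "summable_ideal \<inter> coideal {1..} \<I> \<noteq> {}"
  have ne: ?P if "AOS_dual \<I> \<noteq> {}"
  proof -
    have "\<not> summable_ideal \<subseteq> \<I>" using AOS_dual_empty[OF assms] that by blast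
    then show ?thesis by (auto simp: summable_ideal_def coideal_def)
  qed
  have lin: "Y \<noteq> {}" if "lineable (UNIV :: real set) Y" for Y :: "ell1 set"
    using that not_lineable_empty[of "UNIV :: real set"] by auto
  have spa: "Y \<noteq> {}" if "spaceable Y" for Y :: "ell1 set"
    using that not_spaceable_empty by auto
  have 1: "AOS_ideal \<I> \<noteq> {} \<longleftrightarrow> ?P" "AOS_dual \<I> \<noteq> {} \<longleftrightarrow> ?P"
    using ne sub large(1) lin by blast+
  have 2: "lineable (UNIV :: real set) (AOS_ideal \<I>) \<longleftrightarrow> ?P"
      "lineable (UNIV :: real set) (AOS_dual \<I>) \<longleftrightarrow> ?P"
    using 1 lin large(1) lineable_mono[OF sub] by blast+
  have 3: "spaceable (AOS_ideal \<I>) \<longleftrightarrow> ?P" "spaceable (AOS_dual \<I>) \<longleftrightarrow> ?P"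
    using 1 spa large(2) spaceable_mono[OF sub] by blast+
  show "AOS_ideal \<I> \<noteq> {} \<longleftrightarrow> AOS_dual \<I> \<noteq> {}"
    and "AOS_dual \<I> \<noteq> {} \<longleftrightarrow> lineable (UNIV :: real set) (AOS_ideal \<I>)"
    and "lineable (UNIV :: real set) (AOS_ideal \<I>) \<longleftrightarrow> lineable (UNIV :: real set) (AOS_dual \<I>)"
    and "lineable (UNIV :: real set) (AOS_dual \<I>) \<longleftrightarrow> spaceable (AOS_ideal \<I>)"
    and "spaceable (AOS_ideal \<I>) \<longleftrightarrow> spaceable (AOS_dual \<I>)"
    and "spaceable (AOS_dual \<I>) \<longleftrightarrow> ?P"
    unfolding 1 2 3 by simp_all
qed

end
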